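(* Let $d \ge 2$, $r \ge 2$, $t \ge 2$ be integers and let $\vec{F}$ be a $2$-coherent $r$-direction-vector in $\mathbb{R}^d$. Then $z_d^{\vec{F}}(n; t) = \Omega \bigl( tn^{r-1} \frac{\log n}{\log\log n} \bigr)$, i.e. there is a constant $c>0$ independent of $n$ such that $z_d^{\vec{F}}(n;t)\ge c\, t n^{r-1}\frac{\log n}{\log\log n}$ for every positive integer $n$ (for which the right-hand side is defined).
   Context: An (axis-parallel) box in $\mathbb{R}^d$ is a set $[a_1,b_1]\times\cdots\times[a_d,b_d]$ with real $a_i \le b_i$ (degenerate intervals allowed). Its direction set is $\{i : a_i < b_i\}$. An $r$-direction-vector in $\mathbb{R}^d$ is an $r$-tuple $\vec{F}=(F_1,\dots,F_r)$ of subsets of $\{1,\dots,d\}$. An $r$-tuple $(\mathcal{B}_1,\dots,\mathcal{B}_r)$ of multisets of boxes is an $\vec{F}$-family if every box in $\mathcal{B}_j$ has direction set exactly $F_j$. Its intersection hypergraph has vertices the elements of $\mathcal{B}_1\cup\dots\cup\mathcal{B}_r$, and $\{\mathbf{b}_1,\dots,\mathbf{b}_r\}$ with $\mathbf{b}_j\in\mathcal{B}_j$ is a hyperedge iff $\mathbf{b}_1\cap\dots\cap\mathbf{b}_r\neq\varnothing$. It contains $K^{(r)}_{t,\dots,t}$ if there are $t$-element subsets $S_j\subseteq\mathcal{B}_j$ such that every transversal choice is a hyperedge. $z_d^{\vec{F}}(n;t)$ is the maximum number of hyperedges of a $K^{(r)}_{t,\dots,t}$-free intersection hypergraph of an $\vec{F}$-family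 with $|\mathcal{B}_j|=n$ for all $j$. $\vec{F}$ is $2$-coherent if there exists $k$ with $\bigl|\bigcap_{j\neq k} F_j\bigr|\ge 2$. *)

theory Defs
  imports "HOL-Analysis.Analysis" "HOL-Library.Multiset"
begin

(* R^d is real ^ 'd, with the coordinates {1,...,d} replaced by the finite type 'd.
   An r-tuple is a function on nat of which only the values at 1,...,r matter. *)

(* The endpoints of a box are determined by the box, so S has at most one direction set:
   see direction_set_unique. *)
definition box_with_directions :: "(real ^ 'd) set \<Rightarrow> 'd set \<Rightarrow> bool" where
  "box_with_directions S D \<longleftrightarrow>
     (\<exists>a b. (\<forall>i. a $ i \<le> b $ i) \<and> S = cbox a b \<and> D = {i. a $ i < b $ i})"

definition direction_family ::
    "nat \<Rightarrow> (nat \<Rightarrow> 'd set) \<Rightarrow> (nat \<Rightarrow> (real ^ 'd) set multiset) \<Rightarrow> bool" where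
  "direction_family r F B \<longleftrightarrow> (\<forall>j\<in>{1..r}. \<forall>S\<in>#B j. box_with_directions S (F j))"

(* A multiset with its repeated elements told apart by a copy number. *)
definition copies :: "'a multiset \<Rightarrow> ('a \<times> nat) set" where
  "copies M = {(x, m). m < count M x}"

(* Tagging with the index j keeps the r vertex classes disjoint, even if a box occurs
   in several of the multisets. *)
definition transversal :: "nat \<Rightarrow> (nat \<Rightarrow> 'a \<times> nat) \<Rightarrow> (nat \<times> 'a \<times> nat) set" where
  "transversal r v = (\<lambda>j. (j, v j)) ` {1..r}"

definition hyperedges :: "nat \<Rightarrow> (nat \<Rightarrow> 'a set multiset) \<Rightarrow> (nat \<times> 'a set \<times> nat) set set" where
  "hyperedges r B =
     {transversal r v | v.
        (\<forall>j\<in>{1..r}. v j \<in> copies (B j)) \<and> (\<Inter>j\<in>{1..r}. fst (v j)) \<noteq> {}}"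

definition contains_complete :: "nat \<Rightarrow> nat \<Rightarrow> (nat \<Rightarrow> 'a set multiset) \<Rightarrow> bool" where
  "contains_complete r t B \<longleftrightarrow>
     (\<exists>S. (\<forall>j\<in>{1..r}. S j \<subseteq> copies (B j) \<and> card (S j) = t) \<and>
          (\<forall>v. (\<forall>j\<in>{1..r}. v j \<in> S j) \<longrightarrow> transversal r v \<in> hyperedges r B))"

definition edge_counts :: "nat \<Rightarrow> (nat \<Rightarrow> 'd::finite set) \<Rightarrow> nat \<Rightarrow> nat \<Rightarrow> nat set" where
  "edge_counts r F n t =
     {card (hyperedges r B) | B :: nat \<Rightarrow> (real ^ 'd) set multiset.
        direction_family r F B \<and> (\<forall>j\<in>{1..r}. size (B j) = n) \<and> \<not> contains_complete r t B}"

(* The set is finite and, for r \<ge> 2 and t \<ge> 1, nonempty, so this is a genuine maximum: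
   see finite_edge_counts and edge_counts_nonempty. *)
definition zarankiewicz :: "nat \<Rightarrow> (nat \<Rightarrow> 'd::finite set) \<Rightarrow> nat \<Rightarrow> nat \<Rightarrow> nat" where
  "zarankiewicz r F n t = Max (edge_counts r F n t)"

definition two_coherent :: "nat \<Rightarrow> (nat \<Rightarrow> 'd set) \<Rightarrow> bool" where
  "two_coherent r F \<longleftrightarrow> (\<exists>k\<in>{1..r}. card (\<Inter>j\<in>{1..r} - {k}. F j) \<ge> 2)"

lemma direction_set_unique:
  fixes S :: "(real ^ 'd) set"
  assumes "box_with_directions S D" "box_with_directions S D'"
  shows "D = D'"
proof -
  obtain a b where 1: "\<forall>i. a $ i \<le> b $ i" "S = cbox a b" "D = {i. a $ i < b $ i}"
    using assms(1) unfolding box_with_directions_def by blast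
  obtain a' b' where 2: "\<forall>i. a' $ i \<le> b' $ i" "S = cbox a' b'" "D' = {i. a' $ i < b' $ i}"
    using assms(2) unfolding box_with_directions_def by blast
  have "a \<in> cbox a b" "b \<in> cbox a b" "a' \<in> cbox a' b'" "b' \<in> cbox a' b'"
    using 1(1) 2(1) by (auto simp: mem_box_cart)
  then have "a \<in> cbox a' b'" "b \<in> cbox a' b'" "a' \<in> cbox a b" "b' \<in> cbox a b"
    using 1(2) 2(2) by auto
  then have "a $ i = a' $ i \<and> b $ i = b' $ i" for i
    by (auto simp: mem_box_cart intro: antisym)
  then show ?thesis using 1(3) 2(3) by simp
qed

lemma copies_eq_Sigma: "copies M = (SIGMA x:set_mset M. {..<count M x})"
  by (auto simp: copies_def intro: count_inI)

lemma finite_copies: "finite (copies M)"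
  by (simp add: copies_eq_Sigma)

lemma card_copies: "card (copies M) = size M"
  by (simp add: copies_eq_Sigma size_multiset_overloaded_eq)

lemma finite_edge_counts: "finite (edge_counts r F n t)"
proof -
  have "card (hyperedges r B) \<le> n ^ r" if "\<forall>j\<in>{1..r}. size (B j) = n"
    for B :: "nat \<Rightarrow> (real ^ 'd) set multiset"
  proof -
    let ?P = "PiE {1..r} (\<lambda>j. copies (B j))"
    have "hyperedges r B \<subseteq> transversal r ` ?P"
    proof
      fix e assume "e \<in> hyperedges r B"
      then obtain v where v: "e = transversal r v" "\<forall>j\<in>{1..r}. v j \<in> copies (B j)"
        unfolding hyperedges_def by blast
      have "e = transversal r (restrict v {1..r})"
        unfolding v(1) transversal_def by (rule image_cong) auto
      moreover have "restrict v {1..r} \<in> ?P" using v(2) by auto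
      ultimately show "e \<in> transversal r ` ?P" by blast
    qed
    moreover have fin: "finite ?P" by (rule finite_PiE) (auto simp: finite_copies)
    ultimately have "card (hyperedges r B) \<le> card (transversal r ` ?P)"
      by (intro card_mono) auto
    also have "\<dots> \<le> card ?P" by (rule card_image_le[OF fin])
    also have "\<dots> = n ^ r" using that by (simp add: card_PiE card_copies)
    finally show ?thesis .
  qed
  then have "edge_counts r F n t \<subseteq> {..n ^ r}" unfolding edge_counts_def by auto
  then show ?thesis by (rule finite_subset) simp
qed

lemma edge_counts_nonempty:
  fixes F :: "nat \<Rightarrow> 'd::finite set"
  assumes "r \<ge> 2" "t \<ge> 1"
  shows "edge_counts r F n t \<noteq> {}"
proof -
  define bx :: "nat \<Rightarrow> (real ^ 'd) set" where
    "bx j = cbox (\<chi> i. 2 * real j) (\<chi> i. 2 * real j + (if i \<in> F j then 1 else 0))" for j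
  define B where "B j = replicate_mset n (bx j)" for j
  have disj: "bx 1 \<inter> bx 2 = {}"
  proof -
    have False if "x \<in> bx 1" "x \<in> bx 2" for x
    proof -
      fix i :: 'd
      have "x $ i \<le> 2 + (if i \<in> F 1 then 1 else 0)"
        using that(1)[unfolded bx_def mem_box_cart, THEN spec, of i] by simp
      moreover have "4 \<le> x $ i"
        using that(2)[unfolded bx_def mem_box_cart, THEN spec, of i] by simp
      ultimately show False by (simp split: if_splits)
    qed
    then show ?thesis by blast
  qed
  have no_edges: "hyperedges r B = {}"
  proof -
    have False if v: "\<forall>j\<in>{1..r}. v j \<in> copies (B j)" "(\<Inter>j\<in>{1..r}. fst (v j)) \<noteq> {}" for v
    proof -
      have fst_v: "fst (v j) = bx j" if "j \<in> {1..r}" for j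
      proof -
        have "snd (v j) < count (B j) (fst (v j))"
          using bspec[OF v(1) that] by (simp add: copies_def case_prod_beta)
        then have "count (B j) (fst (v j)) \<noteq> 0" by linarith
        then show ?thesis unfolding B_def count_replicate_mset by (simp split: if_splits)
      qed
      have "(\<Inter>j\<in>{1..r}. fst (v j)) \<subseteq> fst (v 1) \<inter> fst (v 2)" using assms(1) by auto
      also have "\<dots> = {}" using disj fst_v[of 1] fst_v[of 2] assms(1) by simp
      finally show False using v(2) by blast
    qed
    then show ?thesis unfolding hyperedges_def by blast
  qed
  have "\<not> contains_complete r t B"
  proof
    assume "contains_complete r t B"
    then obtain S where S: "\<forall>j\<in>{1..r}. card (S j) = t"
      "\<forall>v. (\<forall>j\<in>{1..r}. v j \<in> S j) \<longrightarrow> transversal r v \<in> hyperedges r B"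
      unfolding contains_complete_def by blast
    have "(SOME x. x \<in> S j) \<in> S j" if "j \<in> {1..r}" for j
    proof -
      have "card (S j) \<noteq> 0" using bspec[OF S(1) that] assms(2) by linarith
      then have "S j \<noteq> {}" by (metis card.empty)
      then show ?thesis by (simp add: some_in_eq)
    qed
    then have "transversal r (\<lambda>j. SOME x. x \<in> S j) \<in> hyperedges r B"
      using S(2)[THEN spec, of "\<lambda>j. SOME x. x \<in> S j"] by blast
    then show False using no_edges by blast
  qed
  moreover have "direction_family r F B"
    unfolding direction_family_def
  proof (intro ballI)
    fix j S assume "S \<in># B j"
    then have "S = bx j" by (simp add: B_def split: if_splits)
    then show "box_with_directions S (F j)"
      unfolding box_with_directions_def bx_def
      by (intro exI[of _ "\<chi> i. 2 * real j"]
          exI[of _ "\<chi> i. 2 * real j + (if i \<in> F j then 1 else 0)"]) simp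
  qed
  moreover have "\<forall>j\<in>{1..r}. size (B j) = n" by (simp add: B_def)
  ultimately have "card (hyperedges r B) \<in> edge_counts r F n t"
    unfolding edge_counts_def by blast
  then show ?thesis by blast
qed

end

theory Submission
  imports Defs
begin

text \<open>
  It suffices to avoid \<open>K\<^sub>2\<^sub>,\<^sub>\<dots>\<^sub>,\<^sub>2\<close>, since \<open>c\<close> may depend on \<open>t\<close>. Let \<open>p \<noteq> q\<close> be common directions of
  all classes but the \<open>k\<close>-th. In the \<open>p\<close>-\<open>q\<close> plane take for class \<open>k\<close> tiny boxes around the points
  \<open>(x, rev x)\<close>, where \<open>rev\<close> reverses the \<open>h\<close> lowest digits of \<open>x\<close> in base \<open>b\<close>, and for another
  class \<open>l\<close> rectangles that fix all digits of \<open>x\<close> but one: the higher digits are fixed by an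
  interval for \<open>x\<close>, the lower ones by an interval for \<open>rev x\<close>. Two such rectangles share at most one
  point, and every point lies in \<open>h\<close> of them. The other classes consist of \<open>n\<close> copies of one huge
  box. With \<open>b = h + 1\<close>, \<open>h\<close> maximal such that \<open>b ^ h \<le> n\<close>, and \<open>x\<close> ranging over the largest
  multiple of \<open>b ^ h\<close> up to \<open>n\<close>, which is at least \<open>n / 2\<close>, there are at most \<open>n\<close> rectangles, and
  \<open>h\<close> is at least of order \<open>log n / log log n\<close>.
\<close>

section \<open>Digit reversal\<close>

fun digit_rev :: "nat \<Rightarrow> nat \<Rightarrow> nat \<Rightarrow> nat" where
  "digit_rev b 0 x = 0"
| "digit_rev b (Suc i) x = b * digit_rev b i x + x div b ^ i mod b"

lemma digit_rev_less:
  assumes "b > 0"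
  shows "digit_rev b i x < b ^ i"
proof (induction i)
  case (Suc i)
  have "b * digit_rev b i x + x div b ^ i mod b < b * (digit_rev b i x + 1)"
    using assms by simp
  also have "\<dots> \<le> b * b ^ i" using Suc by (intro mult_le_mono2) simp
  finally show ?case by simp
qed simp

text \<open>Each division by \<open>b\<close> drops the digit appended last. So the reversed low
  digits of \<open>x\<close> form the leading part of a longer reversal, and prescribing them
  confines that reversal to an interval.\<close>

lemma digit_rev_div:
  assumes "b > 0"
  shows "digit_rev b (i + k) x div b ^ k = digit_rev b i x"
proof (induction k)
  case (Suc k)
  have "digit_rev b (i + Suc k) x div b ^ Suc k
      = (b * digit_rev b (i + k) x + x div b ^ (i + k) mod b) div b div b ^ k"
    by (simp add: div_mult2_eq)
  also have "\<dots> = digit_rev b (i + k) x div b ^ k" using assms by simp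
  finally show ?case using Suc by simp
qed simp

lemma digit_rev_eq_imp_mod_eq:
  assumes "b > 0" "digit_rev b i x = digit_rev b i y"
  shows "x mod b ^ i = y mod b ^ i"
  using assms(2)
proof (induction i)
  case (Suc i)
  have 1: "digit_rev b (Suc i) z div b = digit_rev b i z"
    "digit_rev b (Suc i) z mod b = z div b ^ i mod b" for z
    using assms(1) by simp_all
  have "x mod b ^ i = y mod b ^ i" "x div b ^ i mod b = y div b ^ i mod b"
    using Suc 1[of x] 1[of y] by metis+
  then show ?case by (simp add: mod_mult2_eq mult.commute[of b])
qed simp

text \<open>Rectangles are coded by triples \<open>(i, u, w)\<close>: the digit \<open>i\<close> of \<open>x\<close> is free, \<open>u\<close> collects the
  digits above it and \<open>w\<close> the reversed digits below it.\<close>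

definition digit_line :: "nat \<Rightarrow> nat \<Rightarrow> nat \<Rightarrow> nat \<times> nat \<times> nat" where
  "digit_line b i x = (i, x div b ^ Suc i, digit_rev b i x)"

text \<open>For \<open>i < j\<close>, the line at \<open>j\<close> fixes all digits below
  \<open>j\<close>, hence those up to \<open>i\<close>, and the line at \<open>i\<close> fixes those
  above \<open>i\<close>. Together they determine the point.\<close>

lemma digit_lines_share_one:
  assumes "b > 0" "i \<noteq> j"
    and "digit_line b i x = digit_line b i y" "digit_line b j x = digit_line b j y"
  shows "x = y"
proof -
  have aux: "x = y" if "i < j" "x div b ^ Suc i = y div b ^ Suc i"
      "digit_rev b j x = digit_rev b j y" for i j
  proof -
    have "b ^ Suc i dvd b ^ j" using that(1) by (intro le_imp_power_dvd) simp
    moreover have "x mod b ^ j = y mod b ^ j"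
      using digit_rev_eq_imp_mod_eq[OF assms(1) that(3)] .
    ultimately have "x mod b ^ Suc i = y mod b ^ Suc i" by (metis mod_mod_cancel)
    then show ?thesis using that(2) by (metis div_mult_mod_eq)
  qed
  show ?thesis
    using aux[of i j] aux[of j i] assms(2-) by (auto simp: digit_line_def neq_iff)
qed

text \<open>A free digit \<open>i\<close> leaves at most \<open>m * b ^ (h - 1 - i)\<close> values
  of \<open>u\<close> and \<open>b ^ i\<close> values of \<open>w\<close>; the product does not
  depend on \<open>i\<close>.\<close>

lemma card_digit_lines_le:
  assumes "b > 0"
  shows "card ((\<lambda>(x, i). digit_line b i x) ` ({..<m * b ^ h} \<times> {..<h})) \<le> h * (m * b ^ (h - 1))"
proof -
  let ?S = "SIGMA i:{..<h}. {..<m * b ^ (h - 1 - i)} \<times> {..<b ^ i}"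
  have "digit_line b i x \<in> ?S" if "x < m * b ^ h" "i < h" for x i
  proof -
    have "m * b ^ h = m * b ^ (h - 1 - i) * b ^ Suc i"
      using that(2) by (simp add: power_add[symmetric] mult.assoc del: power_Suc)
    then have "x div b ^ Suc i < m * b ^ (h - 1 - i)"
      using that(1) by (intro less_mult_imp_div_less) metis
    then show ?thesis
      using that(2) digit_rev_less[OF assms] by (simp add: digit_line_def)
  qed
  then have "card ((\<lambda>(x, i). digit_line b i x) ` ({..<m * b ^ h} \<times> {..<h})) \<le> card ?S"
    by (intro card_mono image_subsetI) (clarsimp simp del: mem_Sigma_iff)+
  also have "card ?S = (\<Sum>i<h. m * b ^ (h - 1 - i) * b ^ i)" by (simp add: card_cartesian_product)
  also have "\<dots> = (\<Sum>i<h. m * b ^ (h - 1))"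
    by (intro sum.cong) (auto simp: power_add[symmetric])
  finally show ?thesis by simp
qed

section \<open>Hypergraphs with all but two classes constant\<close>

lemma transversal_eqD:
  assumes "transversal r v = transversal r w" "j \<in> {1..r}"
  shows "v j = w j"
proof -
  have "(j, v j) \<in> transversal r w" using assms unfolding transversal_def by blast
  then show ?thesis unfolding transversal_def by auto
qed

lemma copies_mset_set: "finite A \<Longrightarrow> copies (mset_set A) = A \<times> {0}"
  by (auto simp: copies_def count_mset_set' split: if_splits)

lemma copies_replicate_mset: "copies (replicate_mset n x) = {x} \<times> {..<n}"
  by (auto simp: copies_def split: if_splits)

text \<open>\<open>G\<close> may vary with \<open>j\<close> because each class has its own
  prescribed direction set.\<close>

definition two_class_family ::
    "nat \<Rightarrow> nat \<Rightarrow> 'a set \<Rightarrow> 'a set \<Rightarrow> nat \<Rightarrow> (nat \<Rightarrow> 'a) \<Rightarrow> nat \<Rightarrow> 'a multiset" where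
  "two_class_family k l P R n G j =
     (if j = k then mset_set P else if j = l then mset_set R else replicate_mset n (G j))"

text \<open>Each incident pair extends to a hyperedge by a free choice of one of \<open>n\<close>
  copies in each of the \<open>r - 2\<close> constant classes.\<close>

lemma card_hyperedges_two_class_family:
  assumes kl: "k \<in> {1..r}" "l \<in> {1..r}" "k \<noteq> l" and fin: "finite P" "finite R"
    and E: "E \<subseteq> P \<times> R"
    and inter: "\<And>x y. (x, y) \<in> E \<Longrightarrow> x \<inter> y \<inter> (\<Inter>j\<in>{1..r} - {k, l}. G j) \<noteq> {}"
  shows "card E * n ^ (r - 2) \<le> card (hyperedges r (two_class_family k l P R n G))"
proof -
  let ?B = "two_class_family k l P R n G"
  let ?J = "{1..r} - {k, l}"
  let ?X = "E \<times> (?J \<rightarrow>\<^sub>E {..<n})"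
  define v where "v z j = (if j = k then (fst (fst z), 0) else if j = l then (snd (fst z), 0)
      else (G j, snd z j))" for z :: "('a set \<times> 'a set) \<times> (nat \<Rightarrow> nat)" and j
  have "inj_on (\<lambda>z. transversal r (v z)) ?X"
  proof (rule inj_onI)
    fix z z' assume z: "z \<in> ?X" "z' \<in> ?X" "transversal r (v z) = transversal r (v z')"
    have eq: "v z j = v z' j" if "j \<in> {1..r}" for j using transversal_eqD[OF z(3) that] .
    have "fst z = fst z'"
      using eq[OF kl(1)] eq[OF kl(2)] kl(3) by (simp add: v_def prod_eq_iff)
    moreover have "snd z = snd z'"
    proof (rule PiE_ext[of _ ?J "\<lambda>_. {..<n}"])
      show "snd z \<in> ?J \<rightarrow>\<^sub>E {..<n}" using z(1) by (simp add: mem_Times_iff)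
      show "snd z' \<in> ?J \<rightarrow>\<^sub>E {..<n}" using z(2) by (simp add: mem_Times_iff)
    next
      fix j assume "j \<in> ?J"
      then show "snd z j = snd z' j" using eq[of j] by (simp add: v_def)
    qed
    ultimately show "z = z'" by (simp add: prod_eq_iff)
  qed
  then have "card ?X = card ((\<lambda>z. transversal r (v z)) ` ?X)" by (simp add: card_image)
  also have "\<dots> \<le> card (hyperedges r ?B)"
  proof (rule card_mono)
    have "hyperedges r ?B \<subseteq> Pow ((SIGMA j:{1..r}. copies (?B j)))"
      unfolding hyperedges_def transversal_def by auto
    then show "finite (hyperedges r ?B)"
      by (rule finite_subset) (auto intro!: finite_SigmaI simp: finite_copies)
    show "(\<lambda>z. transversal r (v z)) ` ?X \<subseteq> hyperedges r ?B"
    proof clarify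
      fix x y f assume xy: "(x, y) \<in> E" and f: "f \<in> ?J \<rightarrow>\<^sub>E {..<n}"
      let ?z = "((x, y), f)"
      have "v ?z j \<in> copies (?B j)" if "j \<in> {1..r}" for j
        using that xy f E fin
        by (auto simp: v_def two_class_family_def copies_mset_set copies_replicate_mset)
      moreover obtain s where "s \<in> x \<inter> y \<inter> (\<Inter>j\<in>?J. G j)" using inter[OF xy] by blast
      then have "s \<in> (\<Inter>j\<in>{1..r}. fst (v ?z j))" by (auto simp: v_def)
      ultimately show "transversal r (v ?z) \<in> hyperedges r ?B"
        unfolding hyperedges_def by blast
    qed
  qed
  also have "card ?X = card E * n ^ (r - 2)"
    using kl by (simp add: card_cartesian_product card_PiE card_Diff_subset numeral_2_eq_2)
  finally show ?thesis .
qed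

text \<open>Two vertices from each of the parts \<open>k\<close> and \<open>l\<close> would give a
  4-cycle between \<open>P\<close> and \<open>R\<close>. As these are sets, distinct vertices there
  are distinct boxes.\<close>

lemma not_contains_complete_two_class_family:
  assumes kl: "k \<in> {1..r}" "l \<in> {1..r}" "k \<noteq> l" and fin: "finite P" "finite R" and t: "t \<ge> 2"
    and free: "\<And>x x' y y'. \<lbrakk>x \<in> P; x' \<in> P; y \<in> R; y' \<in> R; x \<inter> y \<noteq> {}; x \<inter> y' \<noteq> {};
        x' \<inter> y \<noteq> {}; x' \<inter> y' \<noteq> {}; x \<noteq> x'\<rbrakk> \<Longrightarrow> y = y'"
  shows "\<not> contains_complete r t (two_class_family k l P R n G)"
proof
  let ?B = "two_class_family k l P R n G"
  assume "contains_complete r t ?B"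
  then obtain S where S: "\<And>j. j \<in> {1..r} \<Longrightarrow> S j \<subseteq> copies (?B j)"
      "\<And>j. j \<in> {1..r} \<Longrightarrow> card (S j) = t"
      "\<And>v. (\<And>j. j \<in> {1..r} \<Longrightarrow> v j \<in> S j) \<Longrightarrow> transversal r v \<in> hyperedges r ?B"
    unfolding contains_complete_def by metis
  have two: "\<exists>x y. x \<in> S j \<and> y \<in> S j \<and> x \<noteq> y" if "j \<in> {1..r}" for j
  proof -
    have "\<not> card (S j) \<le> Suc 0" "finite (S j)"
      using S(2)[OF that] t by (auto intro: card_ge_0_finite)
    then show ?thesis by (auto simp: card_le_Suc0_iff_eq)
  qed
  obtain x x' where x: "x \<in> S k" "x' \<in> S k" "x \<noteq> x'" using two[OF kl(1)] by blast
  obtain y y' where y: "y \<in> S l" "y' \<in> S l" "y \<noteq> y'" using two[OF kl(2)] by blast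
  have meet: "fst a \<inter> fst c \<noteq> {}" if "a \<in> S k" "c \<in> S l" for a c
  proof -
    \<comment> \<open>Arbitrary vertices of the other parts complete \<open>a\<close> and
      \<open>c\<close> to a transversal.\<close>
    define v where "v j = (if j = k then a else if j = l then c else SOME s. s \<in> S j)" for j
    have "v j \<in> S j" if "j \<in> {1..r}" for j
      using two[OF that] \<open>a \<in> S k\<close> \<open>c \<in> S l\<close> by (auto simp: v_def some_in_eq)
    then have "transversal r v \<in> hyperedges r ?B" by (rule S(3))
    then obtain w where w: "transversal r v = transversal r w" "(\<Inter>j\<in>{1..r}. fst (w j)) \<noteq> {}"
      unfolding hyperedges_def by blast
    have "w k = a" "w l = c"
      using transversal_eqD[OF w(1) kl(1)] transversal_eqD[OF w(1) kl(2)] kl(3)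
      by (simp_all add: v_def)
    moreover have "(\<Inter>j\<in>{1..r}. fst (w j)) \<subseteq> fst (w k) \<inter> fst (w l)" using kl by blast
    ultimately show ?thesis using w(2) by blast
  qed
  have "S k \<subseteq> P \<times> {0}" "S l \<subseteq> R \<times> {0}"
    using S(1)[OF kl(1)] S(1)[OF kl(2)] kl(3) fin
    by (simp_all add: two_class_family_def copies_mset_set)
  then have "x \<in> P \<times> {0}" "x' \<in> P \<times> {0}" "y \<in> R \<times> {0}" "y' \<in> R \<times> {0}" using x y by blast+
  then have mem: "fst x \<in> P" "fst x' \<in> P" "fst y \<in> R" "fst y' \<in> R"
    and ne: "fst x \<noteq> fst x'" "fst y \<noteq> fst y'"
    using x(3) y(3) by (auto simp: prod_eq_iff)
  show False
    using free[OF mem] meet x(1,2) y(1,2) ne by blast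
qed

section \<open>Boxes over a coordinate plane\<close>

text \<open>Outside \<open>p\<close> and \<open>q\<close> every side is \<open>[0,1]\<close> or
  \<open>{0}\<close> and contains 0, so whether boxes meet is decided in the plane.\<close>

definition plane_box ::
    "'d::finite \<Rightarrow> 'd \<Rightarrow> 'd set \<Rightarrow> real \<Rightarrow> real \<Rightarrow> real \<Rightarrow> real \<Rightarrow> (real ^ 'd) set" where
  "plane_box p q D x x' y y' =
     cbox (\<chi> i. if i = p then x else if i = q then y else 0)
          (\<chi> i. if i = p then x' else if i = q then y' else if i \<in> D then 1 else 0)"

lemma box_with_directions_plane_box:
  assumes "p \<noteq> q" "x \<le> x'" "y \<le> y'" "p \<in> D \<longleftrightarrow> x < x'" "q \<in> D \<longleftrightarrow> y < y'"
  shows "box_with_directions (plane_box p q D x x' y y') D"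
  unfolding box_with_directions_def plane_box_def
  by (intro exI conjI) (use assms in \<open>auto split: if_splits\<close>)

lemma plane_box_mem:
  assumes "p \<noteq> q" "x \<le> a" "a \<le> x'" "y \<le> c" "c \<le> y'"
  shows "(\<chi> i. if i = p then a else if i = q then c else 0) \<in> plane_box p q D x x' y y'"
  using assms by (auto simp: plane_box_def mem_box_cart)

lemma plane_box_Int_nonemptyD:
  assumes "p \<noteq> q" "plane_box p q D x x' y y' \<inter> plane_box p q D' a a' c c' \<noteq> {}"
  shows "x \<le> a'" "a \<le> x'" "y \<le> c'" "c \<le> y'"
proof -
  obtain s where s: "s \<in> plane_box p q D x x' y y'" "s \<in> plane_box p q D' a a' c c'"
    using assms(2) by blast
  show "x \<le> a'" "a \<le> x'" "y \<le> c'" "c \<le> y'"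
    using s[unfolded plane_box_def mem_box_cart, THEN spec, of p]
      s[unfolded plane_box_def mem_box_cart, THEN spec, of q] assms(1) by auto
qed

lemma plane_box_eqD:
  assumes "p \<noteq> q" "x \<le> x'" "y \<le> y'" "plane_box p q D x x' y y' = plane_box p q D a a' c c'"
  shows "x = a \<and> x' = a' \<and> y = c \<and> y' = c'"
proof -
  let ?lo = "\<lambda>x y. (\<chi> i. if i = p then x else if i = q then y else 0) :: real ^ 'a"
  let ?hi = "\<lambda>x y. (\<chi> i. if i = p then x else if i = q then y else if i \<in> D then 1 else 0) :: real ^ 'a"
  \<comment> \<open>Equal boxes have equal corners only if they are nonempty.\<close>
  have "plane_box p q D x x' y y' \<noteq> {}"
    using plane_box_mem[of p q x x x' y y y' D] assms(1-3) by auto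
  then have "?lo x y = ?lo a c" "?hi x' y' = ?hi a' c'"
    using assms(4) unfolding plane_box_def eq_cbox by blast+
  then have "?lo x y $ p = ?lo a c $ p" "?lo x y $ q = ?lo a c $ q"
    "?hi x' y' $ p = ?hi a' c' $ p" "?hi x' y' $ q = ?hi a' c' $ q" by simp_all
  then show ?thesis using assms(1) by simp
qed

text \<open>The sides \<open>1/4\<close> and the cut-off \<open>1/2\<close> give the boxes their prescribed directions while, on
  integer corners, a point box meets a cell iff the point lies in the half-open integer cell.\<close>

definition point_box :: "'d::finite \<Rightarrow> 'd \<Rightarrow> 'd set \<Rightarrow> nat \<times> nat \<Rightarrow> (real ^ 'd) set" where
  "point_box p q D z = (case z of (x, y) \<Rightarrow>
     plane_box p q D (real x) (real x + (if p \<in> D then 1/4 else 0))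
       (real y) (real y + (if q \<in> D then 1/4 else 0)))"

definition cell_box ::
    "'d::finite \<Rightarrow> 'd \<Rightarrow> 'd set \<Rightarrow> nat \<Rightarrow> nat \<Rightarrow> nat \<times> nat \<times> nat \<Rightarrow> (real ^ 'd) set" where
  "cell_box p q D b h z = (case z of (i, u, w) \<Rightarrow>
     plane_box p q D
       (real (u * b ^ Suc i)) (real (u * b ^ Suc i + b ^ Suc i) - 1/2)
       (real (w * b ^ (h - i))) (real (w * b ^ (h - i) + b ^ (h - i)) - 1/2))"

lemma inj_point_box: "p \<noteq> q \<Longrightarrow> inj (point_box p q D)"
  by (rule injI) (auto simp: point_box_def dest!: plane_box_eqD[rotated 3])

lemma box_with_directions_point_box:
  "p \<noteq> q \<Longrightarrow> box_with_directions (point_box p q D z) D"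
  by (cases z) (auto simp: point_box_def intro!: box_with_directions_plane_box)

lemma half_less_real_power:
  assumes "b > (0::nat)"
  shows "1/2 < real (b ^ i)"
proof -
  have "real (b ^ i) \<ge> 1" using assms by (subst real_of_nat_ge_one_iff) simp
  then show ?thesis by simp
qed

lemma box_with_directions_cell_box:
  assumes "p \<noteq> q" "p \<in> D" "q \<in> D" "b > 0"
  shows "box_with_directions (cell_box p q D b h z) D"
proof (cases z)
  case (fields i u w)
  have "real a < real (a + b ^ j) - 1/2" for a j
    using half_less_real_power[OF assms(4), of j] unfolding of_nat_add by linarith
  then show ?thesis
    unfolding cell_box_def fields prod.case
    using assms by (intro box_with_directions_plane_box) (auto intro: less_imp_le simp del: power_Suc of_nat_add of_nat_mult of_nat_power)
qed

lemma inj_cell_box: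
  assumes "p \<noteq> q" "b \<ge> 2"
  shows "inj (cell_box p q D b h)"
proof (rule injI)
  fix z z' assume eq: "cell_box p q D b h z = cell_box p q D b h z'"
  obtain i u w where z: "z = (i, u, w)" by (cases z)
  obtain i' u' w' where z': "z' = (i', u', w')" by (cases z')
  have b: "b > 0" using assms by simp
  have *: "real (u * b ^ Suc i) = real (u' * b ^ Suc i') \<and>
      real (u * b ^ Suc i + b ^ Suc i) - 1/2 = real (u' * b ^ Suc i' + b ^ Suc i') - 1/2 \<and>
      real (w * b ^ (h - i)) = real (w' * b ^ (h - i')) \<and>
      real (w * b ^ (h - i) + b ^ (h - i)) - 1/2 = real (w' * b ^ (h - i') + b ^ (h - i')) - 1/2"
  proof (rule plane_box_eqD[OF assms(1)])
    show "real (u * b ^ Suc i) \<le> real (u * b ^ Suc i + b ^ Suc i) - 1/2"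
      "real (w * b ^ (h - i)) \<le> real (w * b ^ (h - i) + b ^ (h - i)) - 1/2"
      using half_less_real_power[OF b, of "Suc i"] half_less_real_power[OF b, of "h - i"]
      unfolding of_nat_add by linarith+
  qed (use eq in \<open>unfold z z' cell_box_def prod.case\<close>)
  then have nat: "u * b ^ Suc i = u' * b ^ Suc i'" "w * b ^ (h - i) = w' * b ^ (h - i')"
    unfolding of_nat_eq_iff by blast+
  have "real (u * b ^ Suc i + b ^ Suc i) = real (u' * b ^ Suc i' + b ^ Suc i')" using * by argo
  then have "u * b ^ Suc i + b ^ Suc i = u' * b ^ Suc i' + b ^ Suc i'"
    unfolding of_nat_eq_iff .
  \<comment> \<open>The width in direction \<open>p\<close> reveals \<open>i\<close> since
    \<open>b \<ge> 2\<close>; the lower corner then gives \<open>u\<close> and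
    \<open>w\<close>.\<close>
  then have "b ^ Suc i = b ^ Suc i'" using nat(1) by linarith
  then have "i = i'" using assms(2) by (simp add: power_inject_exp del: power_Suc)
  then show "z = z'" using nat b by (simp add: z z')
qed

text \<open>Both fixed parts are quotients, the second being
  \<open>digit_rev b h x div b ^ (h - i)\<close>, and a quotient is fixed by a half-open
  interval.\<close>

lemma digit_point_in_cell:
  assumes "b > 0" "i \<le> h"
  shows "digit_line b i x = (i, u, w) \<longleftrightarrow>
     u * b ^ Suc i \<le> x \<and> x < u * b ^ Suc i + b ^ Suc i \<and>
     w * b ^ (h - i) \<le> digit_rev b h x \<and> digit_rev b h x < w * b ^ (h - i) + b ^ (h - i)"
proof -
  have div: "a div m = c \<longleftrightarrow> c * m \<le> a \<and> a < c * m + m" if "m > 0" for a m c :: nat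
    using that dividend_less_div_times[OF that, of a] by (auto simp: div_nat_eqI algebra_simps)
  have "digit_rev b i x = digit_rev b h x div b ^ (h - i)"
    using digit_rev_div[OF assms(1), of i "h - i" x] assms(2) by simp
  then show ?thesis
    using assms(1) div[of "b ^ Suc i" x u] div[of "b ^ (h - i)" "digit_rev b h x" w]
    by (simp add: digit_line_def del: power_Suc)
qed

lemma point_cell_box_Int:
  assumes "p \<noteq> q" "b > 0" "i \<le> h"
    and "point_box p q D (x, digit_rev b h x) \<inter> cell_box p q D' b h (i, u, w) \<noteq> {}"
  shows "digit_line b i x = (i, u, w)"
proof -
  let ?y = "digit_rev b h x"
  have *: "real x \<le> real (u * b ^ Suc i + b ^ Suc i) - 1/2"
    "real (u * b ^ Suc i) \<le> real x + (if p \<in> D then 1/4 else 0)"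
    "real ?y \<le> real (w * b ^ (h - i) + b ^ (h - i)) - 1/2"
    "real (w * b ^ (h - i)) \<le> real ?y + (if q \<in> D then 1/4 else 0)"
    using plane_box_Int_nonemptyD[OF assms(1) assms(4)[unfolded point_box_def cell_box_def prod.case]]
    by simp_all
  have lt: "a < c" if "real a \<le> real c - 1/2" for a c using that by linarith
  have le: "a \<le> c" if "real a \<le> real c + (if Q then 1/4 else 0)" for a c Q
    using that by (cases Q; simp; linarith)
  show ?thesis
    unfolding digit_point_in_cell[OF assms(2,3)]
    using lt[OF *(1)] le[OF *(2)] lt[OF *(3)] le[OF *(4)] by blast
qed

lemma digit_line_cell_box_mem:
  assumes "p \<noteq> q" "b > 0" "i \<le> h"
  shows "(\<chi> j. if j = p then real x else if j = q then real (digit_rev b h x) else 0)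
    \<in> cell_box p q D b h (digit_line b i x)"
proof -
  obtain u w where uw: "digit_line b i x = (i, u, w)" by (simp add: digit_line_def)
  have "real a \<le> real c - 1/2" if "a < c" for a c using that by linarith
  then show ?thesis
    using uw digit_point_in_cell[OF assms(2,3), of x u w]
    unfolding uw cell_box_def prod.case
    by (intro plane_box_mem[OF assms(1)]) (simp_all del: power_Suc of_nat_add of_nat_mult of_nat_power)
qed

section \<open>The construction\<close>

text \<open>Each of \<open>m * b ^ h\<close> points lies on \<open>h\<close> lines, and
  \<open>h \<le> b\<close> keeps the number of these lines at most
  \<open>m * b ^ h \<le> n\<close>.\<close>

lemma digit_construction:
  fixes F :: "nat \<Rightarrow> 'd::finite set"
  assumes pq: "p \<noteq> q" and coh: "\<And>j. j \<in> {1..r} - {k} \<Longrightarrow> p \<in> F j \<and> q \<in> F j"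
    and kl: "k \<in> {1..r}" "l \<in> {1..r}" "k \<noteq> l" and t: "t \<ge> 2"
    and b: "b \<ge> 2" "h \<le> b" and m: "m * b ^ h \<le> n"
  shows "m * b ^ h * h * n ^ (r - 2) \<le> zarankiewicz r F n t"
proof -
  have b0: "b > 0" using b by simp
  define T0 where "T0 = (\<lambda>(x, i). digit_line b i x) ` ({..<m * b ^ h} \<times> {..<h})"
  \<comment> \<open>Allowing \<open>fst z = h\<close> keeps \<open>U\<close> infinite even for
    \<open>h = 0\<close>.\<close>
  define U where "U = {z :: nat \<times> nat \<times> nat. fst z \<le> h}"
  have "card T0 \<le> h * (m * b ^ (h - 1))" unfolding T0_def by (rule card_digit_lines_le[OF b0])
  also have "\<dots> \<le> m * b ^ h"
  proof (cases h)
    case (Suc g)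
    have "h * (m * b ^ (h - 1)) \<le> b * (m * b ^ (h - 1))" using b(2) by (rule mult_le_mono1)
    then show ?thesis using Suc by (simp add: mult.left_commute)
  qed simp
  finally have cT0: "card T0 \<le> n" using m by simp
  have T0: "finite T0" "T0 \<subseteq> U" unfolding T0_def U_def by (auto simp: digit_line_def)
  have "infinite ((\<lambda>u. (0, u, 0)) ` UNIV :: (nat \<times> nat \<times> nat) set)"
    by (subst finite_image_iff) (auto intro: inj_onI)
  then have "infinite U" by (rule infinite_super[rotated]) (auto simp: U_def)
  then have "infinite (U - T0)" using T0 by simp
  then obtain T1 where T1: "T1 \<subseteq> U - T0" "finite T1" "card T1 = n - card T0"
    using infinite_arbitrarily_large by blast
  \<comment> \<open>Padding with digit lines for arbitrary \<open>u\<close> and \<open>w\<close> is harmless: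
    any two digit lines share at most one point.\<close>
  define T where "T = T0 \<union> T1"
  have "card T = card T0 + card T1"
    unfolding T_def using T1 T0 by (intro card_Un_disjoint) auto
  then have T: "T0 \<subseteq> T" "T \<subseteq> U" "finite T" "card T = n"
    using T0 T1 cT0 by (auto simp: T_def)
  define pt where "pt x = point_box p q (F k) (x, digit_rev b h x)" for x
  define cell where "cell = cell_box p q (F l) b h"
  \<comment> \<open>Points with \<open>x \<ge> m * b ^ h\<close> only fill the class up to size
    \<open>n\<close>; \<open>E\<close> does not count them.\<close>
  define P where "P = pt ` {..<n}"
  define R where "R = cell ` T"
  \<comment> \<open>\<open>M\<close> bounds \<open>x < n\<close> and reversals below
    \<open>b ^ h\<close>, and is positive even for \<open>n = 0\<close>, so \<open>p\<close> and
    \<open>q\<close> are directions of \<open>G j\<close>.\<close>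
  define M where "M = real n + real (b ^ h)"
  define G where "G j = plane_box p q (F j) 0 M 0 M" for j
  define E where "E = (\<lambda>(x, i). (pt x, cell (digit_line b i x))) ` ({..<m * b ^ h} \<times> {..<h})"
  let ?B = "two_class_family k l P R n G"
  have inj_pt: "inj pt"
    using inj_point_box[OF pq, of "F k"] unfolding pt_def by (auto intro!: injI dest: injD)
  have inj_cell: "inj cell" unfolding cell_def using inj_cell_box[OF pq b(1)] .
  have fin: "finite P" "finite R" using T by (auto simp: P_def R_def)
  have card: "card P = n" "card R = n"
    using T inj_pt inj_cell by (simp_all add: P_def R_def card_image inj_on_subset)
  have Fl: "p \<in> F l" "q \<in> F l" using coh kl by auto
  have "M > 0" using b0 unfolding M_def by (simp add: add_nonneg_pos)
  have "box_with_directions S (F j)" if "j \<in> {1..r}" "S \<in># ?B j" for j S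
  proof (cases "j = k \<or> j = l")
    case True
    then show ?thesis
      using that fin kl(3) box_with_directions_point_box[OF pq] box_with_directions_cell_box[OF pq Fl b0]
      by (auto simp: two_class_family_def P_def R_def pt_def cell_def)
  next
    case False
    then have "S = G j" using that by (simp add: two_class_family_def split: if_splits)
    then show ?thesis
      using coh[of j] that(1) False \<open>M > 0\<close> pq
      by (auto simp: G_def intro!: box_with_directions_plane_box)
  qed
  then have dir: "direction_family r F ?B" by (auto simp: direction_family_def)
  have sizes: "size (?B j) = n" for j by (simp add: two_class_family_def card)
  have "\<not> contains_complete r t ?B"
  proof (rule not_contains_complete_two_class_family[OF kl fin t])
    fix X X' Y Y' assume XY: "X \<in> P" "X' \<in> P" "Y \<in> R" "Y' \<in> R" "X \<inter> Y \<noteq> {}" "X \<inter> Y' \<noteq> {}"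
      "X' \<inter> Y \<noteq> {}" "X' \<inter> Y' \<noteq> {}" "X \<noteq> X'"
    obtain x x' z z' where X: "X = pt x" "X' = pt x'" and Y: "Y = cell z" "z \<in> T" "Y' = cell z'" "z' \<in> T"
      using XY(1-4) by (auto simp: P_def R_def)
    have line: "digit_line b (fst z) x = z" if "z \<in> T" "pt x \<inter> cell z \<noteq> {}" for z x
      using that T(2) point_cell_box_Int[OF pq b0, of "fst z" h "F k" x "F l" "fst (snd z)" "snd (snd z)"]
      by (auto simp: pt_def cell_def U_def)
    have z: "digit_line b (fst z) x = z" "digit_line b (fst z) x' = z"
      "digit_line b (fst z') x = z'" "digit_line b (fst z') x' = z'"
      using XY X Y line by auto
    have "x \<noteq> x'" using XY(9) X by blast
    \<comment> \<open>Different free digits would force \<open>x = x'\<close>. With the same free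
      digit, both cells carry the line of \<open>x\<close> for that digit.\<close>
    then have "fst z = fst z'"
      using digit_lines_share_one[OF b0, of "fst z" "fst z'" x x'] z by metis
    then show "Y = Y'" using z Y by metis
  qed
  then have "card (hyperedges r ?B) \<in> edge_counts r F n t"
    using dir sizes unfolding edge_counts_def by blast
  then have "card (hyperedges r ?B) \<le> zarankiewicz r F n t"
    unfolding zarankiewicz_def by (rule Max_ge[OF finite_edge_counts])
  moreover have "card E * n ^ (r - 2) \<le> card (hyperedges r ?B)"
  proof (rule card_hyperedges_two_class_family[OF kl fin])
    show "E \<subseteq> P \<times> R" using m T(1) by (force simp: E_def P_def R_def T0_def)
  next
    fix X Y assume "(X, Y) \<in> E"
    then obtain x i where xi: "x < m * b ^ h" "i < h" "X = pt x" "Y = cell (digit_line b i x)"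
      by (auto simp: E_def)
    let ?s = "\<chi> j. if j = p then real x else if j = q then real (digit_rev b h x) else 0"
    have "?s \<in> X" unfolding xi pt_def point_box_def prod.case
      by (intro plane_box_mem[OF pq]) auto
    moreover have "?s \<in> Y"
      unfolding xi cell_def using digit_line_cell_box_mem[OF pq b0] xi(2) by simp
    moreover have "?s \<in> G j" for j
    proof -
      have "real x \<le> M" using xi(1) m b0 unfolding M_def by (simp add: add_increasing2)
      moreover have "real (digit_rev b h x) \<le> M"
        unfolding M_def using digit_rev_less[OF b0, of h x] by linarith
      ultimately show ?thesis unfolding G_def by (intro plane_box_mem[OF pq]) auto
    qed
    ultimately show "X \<inter> Y \<inter> (\<Inter>j\<in>{1..r} - {k, l}. G j) \<noteq> {}" by blast
  qed
  moreover have "card E = m * b ^ h * h"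
  proof -
    have "inj_on (\<lambda>(x, i). (pt x, cell (digit_line b i x))) ({..<m * b ^ h} \<times> {..<h})"
      by (rule inj_onI) (auto simp: digit_line_def dest!: injD[OF inj_pt] injD[OF inj_cell])
    then show ?thesis by (simp add: E_def card_image card_cartesian_product)
  qed
  ultimately show ?thesis by simp
qed

section \<open>Choice of the number of digits\<close>

text \<open>\<open>h + 1\<close> is the least \<open>k\<close> with \<open>n < (k + 1) ^ k\<close>;
  \<open>n \<ge> 2\<close> excludes \<open>k = 0\<close> and \<open>k = 1\<close>.\<close>

lemma exists_digit_number:
  fixes n :: nat
  assumes "n \<ge> 2"
  obtains h where "h \<ge> 1" "(h + 1) ^ h \<le> n" "n < (h + 2) ^ (h + 1)"
proof -
  let ?Q = "\<lambda>k::nat. n < (k + 1) ^ k"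
  have "n < 2 ^ n" by (rule less_exp)
  also have "\<dots> \<le> (n + 1) ^ n" using assms by (intro power_mono) auto
  finally have ex: "?Q n" .
  define k where "k = (LEAST k. ?Q k)"
  have Qk: "?Q k" unfolding k_def by (rule LeastI[of ?Q, OF ex])
  have "k \<noteq> 0" using Qk assms by (intro notI) simp
  moreover have "k \<noteq> 1" using Qk assms by (intro notI) simp
  ultimately obtain h where h: "k = Suc h" "h \<ge> 1" by (cases k) auto
  have "\<not> ?Q h" using not_less_Least[of h ?Q] h unfolding k_def by simp
  then show ?thesis using that[of h] Qk h by simp
qed

lemma ln_over_ln_ln_le:
  obtains K :: real where "K > 0"
    "\<And>n h. n \<ge> (3::nat) \<Longrightarrow> n < (h + 2) ^ (h + 1) \<Longrightarrow> ln n / ln (ln n) \<le> K * (real h + 2)"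
proof
  \<comment> \<open>A positive lower bound for \<open>ln (ln n)\<close> over all
    \<open>n \<ge> 3\<close>.\<close>
  define \<delta> :: real where "\<delta> = ln (ln 3)"
  have ln3: "ln 3 > (1::real)" 
  proof -
    have "exp (1::real) < 3" using e_less_272 by simp
    then have "ln (exp 1) < ln (3::real)" by (subst ln_less_cancel_iff) auto
    then show ?thesis by simp
  qed
  have \<delta>: "\<delta> > 0" unfolding \<delta>_def using ln3 by simp
  show "1 + 3 / \<delta> > 0" using \<delta> by (simp add: add_pos_nonneg)
  fix n h :: nat assume n: "n \<ge> 3" "n < (h + 2) ^ (h + 1)"
  define L where "L = ln (real n)"
  have "ln 3 \<le> L" unfolding L_def using n by simp
  then have L: "L > 1" "ln L \<ge> \<delta>" using ln3 unfolding \<delta>_def by auto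
  have "L / ln L \<le> (1 + 3 / \<delta>) * (real h + 2)"
  \<comment> \<open>If \<open>ln L \<ge> 1\<close>, then \<open>h + 2 < L / ln L\<close> would give
    \<open>h + 2 < L\<close> and so \<open>(h + 1) * ln (h + 2) < L\<close>, against the upper bound
    on \<open>n\<close>. Otherwise \<open>L \<le> 3\<close>, and the quotient is at most
    \<open>3 / \<delta>\<close>.\<close>
  proof (cases "ln L \<ge> 1")
    case True
    have "L / ln L \<le> real h + 2"
    proof (rule ccontr)
      assume "\<not> L / ln L \<le> real h + 2"
      then have less: "(real h + 2) < L / ln L" by simp
      also have "\<dots> \<le> L" using True L by (simp add: divide_le_eq mult_le_cancel_left1)
      finally have "ln (real h + 2) \<le> ln L" by simp
      then have "(real h + 1) * ln (real h + 2) \<le> (real h + 2) * ln L"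
        by (intro mult_mono) auto
      also have "\<dots> < L" using less True by (simp add: less_divide_eq)
      finally have "(real h + 1) * ln (real h + 2) < L" .
      moreover have "L < (real h + 1) * ln (real h + 2)"
      proof -
        have "real n < real ((h + 2) ^ (h + 1))" using n(2) by (simp only: of_nat_less_iff)
        also have "\<dots> = (real h + 2) ^ (h + 1)" by (simp only: of_nat_power of_nat_add of_nat_numeral)
        finally have "real n < (real h + 2) ^ (h + 1)" .
        then have "L < ln ((real h + 2) ^ (h + 1))" unfolding L_def using n(1) by (subst ln_less_cancel_iff) auto
        also have "\<dots> = (real h + 1) * ln (real h + 2)" by (subst ln_realpow) auto
        finally show ?thesis .
      qed
      ultimately show False by simp
    qed
    also have "\<dots> \<le> (1 + 3 / \<delta>) * (real h + 2)" using \<delta> by (simp add: mult_le_cancel_right1)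
    finally show ?thesis .
  next
    case False
    have "L = exp (ln L)" using L by simp
    also have "\<dots> \<le> exp 1" using False by (subst exp_le_cancel_iff) simp
    also have "\<dots> \<le> 3" by (rule exp_le)
    finally have "L / ln L \<le> 3 / \<delta>" using L \<delta> by (intro frac_le) auto
    also have "\<dots> \<le> (1 + 3 / \<delta>) * 1" by simp
    also have "\<dots> \<le> (1 + 3 / \<delta>) * (real h + 2)" using \<delta> by (intro mult_left_mono) (auto intro: add_nonneg_nonneg)
    finally show ?thesis .
  qed
  then show "ln n / ln (ln n) \<le> (1 + 3 / \<delta>) * (real h + 2)" unfolding L_def .
qed

theorem theorem2p1:
  fixes F :: "nat \<Rightarrow> 'd::finite set" and r t :: nat
  assumes "CARD('d) \<ge> 2" and "r \<ge> 2" and "t \<ge> 2"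
    and "two_coherent r F"
  shows "\<exists>c::real. c > 0 \<and>
           (\<forall>n::nat. n \<ge> 2 \<longrightarrow>
              real (zarankiewicz r F n t) \<ge>
                c * (real t * real n ^ (r - 1) * (ln (real n) / ln (ln (real n)))))"
proof -
  obtain k where k: "k \<in> {1..r}" "card (\<Inter>j\<in>{1..r} - {k}. F j) \<ge> 2"
    using assms(4) unfolding two_coherent_def by blast
  then have "\<not> card (\<Inter>j\<in>{1..r} - {k}. F j) \<le> Suc 0" by simp
  then obtain p q where pq: "p \<noteq> q" "p \<in> (\<Inter>j\<in>{1..r} - {k}. F j)" "q \<in> (\<Inter>j\<in>{1..r} - {k}. F j)"
    by (auto simp: card_le_Suc0_iff_eq[OF finite])
  define l :: nat where "l = (if k = 1 then 2 else 1)"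
  have l: "l \<in> {1..r}" "k \<noteq> l" using assms(2) by (auto simp: l_def)
  obtain K :: real where K: "K > 0"
    "\<And>n h. n \<ge> (3::nat) \<Longrightarrow> n < (h + 2) ^ (h + 1) \<Longrightarrow> ln n / ln (ln n) \<le> K * (real h + 2)"
    by (rule ln_over_ln_ln_le) blast
  \<comment> \<open>The 6 combines \<open>h + 2 \<le> 3 * h\<close> with
    \<open>n \<le> 2 * (m * N)\<close>; the factor \<open>t\<close> of the bound cancels.\<close>
  define c where "c = 1 / (6 * K * real t)"
  have c: "c > 0" using K assms(3) by (simp add: c_def)
  show ?thesis
  proof (intro exI[of _ c] conjI c allI impI)
    fix n :: nat assume n: "n \<ge> 2"
    let ?q = "ln (real n) / ln (ln (real n))"
    show "real (zarankiewicz r F n t) \<ge> c * (real t * real n ^ (r - 1) * ?q)"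
    \<comment> \<open>Since \<open>ln (ln 2)\<close> is negative, the bound for \<open>n = 2\<close>
      is trivial.\<close>
    proof (cases "n = 2")
      case True
      have "ln (2::real) \<le> 1" using ln_le_minus_one[of "2::real"] by simp
      then have "ln (ln (2::real)) \<le> 0" by (subst ln_le_zero_iff) auto
      then have "?q \<le> 0" using True by (simp add: divide_nonneg_nonpos)
      then have "c * (real t * real n ^ (r - 1) * ?q) \<le> 0"
        using c by (intro mult_nonneg_nonpos) auto
      then show ?thesis by (rule order_trans) simp
    next
      case False
      then have n3: "n \<ge> 3" using n by simp
      obtain h where h: "h \<ge> 1" "(h + 1) ^ h \<le> n" "n < (h + 2) ^ (h + 1)"
        using exists_digit_number[OF n] by blast
      define N where "N = (h + 1) ^ h"
      define m where "m = n div N"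
      have "N > 0" by (simp add: N_def)
      then have "m \<ge> 1" using h(2) unfolding m_def N_def[symmetric] by (simp add: div_greater_zero_iff Suc_le_eq)
      then have "N \<le> m * N" by simp
      moreover have "n < m * N + N"
        using \<open>N > 0\<close> unfolding m_def by (metis add.commute dividend_less_times_div mult.commute)
      ultimately have half: "n \<le> 2 * (m * N)" by linarith
      have mN: "m * N \<le> n" unfolding m_def by simp
      have main: "m * N * h * n ^ (r - 2) \<le> zarankiewicz r F n t"
        unfolding N_def
      proof (rule digit_construction[OF pq(1) _ k(1) l assms(3)])
        show "p \<in> F j \<and> q \<in> F j" if "j \<in> {1..r} - {k}" for j using pq that by blast
      qed (use h mN in \<open>auto simp: N_def\<close>)
      have "?q \<le> K * (real h + 2)" using K(2)[OF n3 h(3)] .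
      also have "\<dots> \<le> K * (3 * real h)" using h(1) K(1) by (intro mult_left_mono) auto
      finally have q: "?q \<le> K * (3 * real h)" .
      have "c * (real t * real n ^ (r - 1) * ?q) = ?q * (real n ^ (r - 1) / (6 * K))"
        using assms(3) K(1) by (simp add: c_def field_simps)
      also have "\<dots> \<le> K * (3 * real h) * (real n ^ (r - 1) / (6 * K))"
        using q K(1) by (intro mult_right_mono) auto
      also have "\<dots> = real n ^ (r - 1) * real h / 2" using K(1) by (simp add: field_simps)
      also have "\<dots> = real n / 2 * real h * real n ^ (r - 2)"
        using assms(2) by (simp add: power_Suc[symmetric] Suc_diff_Suc numeral_2_eq_2 del: power_Suc)
      also have "\<dots> \<le> real (m * N) * real h * real n ^ (r - 2)"
        using half[folded of_nat_le_iff[where 'a = real]] by (intro mult_right_mono) auto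
      also have "\<dots> = real (m * N * h * n ^ (r - 2))" by simp
      also have "\<dots> \<le> real (zarankiewicz r F n t)" using main by (simp only: of_nat_le_iff)
      finally show ?thesis .
    qed
  qed
qed

end
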